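(* Let $X,Y$ be metric spaces, $F:X\rightrightarrows Y$ a set-valued mapping and $(\bar x,\bar y)\in\mathrm{gph}\,F$. Then: (i) ${}^{s}r[F](\bar x,\bar y)\le\overline{|\nabla F|}{}^{\diamond}(\bar x,\bar y)$; (ii) if $X$ and $Y$ are complete and $\mathrm{gph}\,F$ is locally closed (in the product topology) near $(\bar x,\bar y)$, then ${}^{s}r[F](\bar x,\bar y)=\overline{|\nabla F|}{}^{\diamond}(\bar x,\bar y)$.
   Context: All metrics are denoted by $d$. $\mathrm{gph}\,F:=\{(x,y)\mid y\in F(x)\}$, $F^{-1}(y):=\{x\mid y\in F(x)\}$. A set $\Omega$ is locally closed near $z\in\Omega$ if $\Omega\cap U$ is closed for some closed neighbourhood $U$ of $z$. $\alpha_+:=\max\{\alpha,0\}$. Conventions: $\inf\emptyset=+\infty$ (so $d(\bar y,\emptyset)=+\infty$), $c/0=+\infty$ for $c\in[0,+\infty]$, and the supremum over the empty set of nonnegative quotients is $0$. The constant $${}^{s}r[F](\bar x,\bar y):=\liminf_{x\to\bar x,\ x\notin F^{-1}(\bar y)}\frac{d(\bar y,F(x))}{d(x,F^{-1}(\bar y))}$$ characterizes metric subregularity: it is the supremum of all $\tau>0$ such that $\tau d(x,F^{-1}(\bar y))\le d(\bar y,F(x))$ for all $x$ in some neighbourhood of $\bar x$. For $\rho>0$, $d_\rho((u,v),(x,y)):=\max\{d(u,x),\rho\,d(v,y)\}$. For $(x,y)\in\mathrm{gph}\,F$, the nonlocal $\rho$-slope of $F$ is $$|\nabla F|^{\diamond}_\rho(x,y):=\sup_{(u,v)\in\mathrm{gph}\,F,\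 (u,v)\ne(x,y)}\frac{[d(y,\bar y)-d(v,\bar y)]_+}{d_\rho((u,v),(x,y))},$$ and the uniform strict slope of $F$ at $(\bar x,\bar y)$ is $$\overline{|\nabla F|}{}^{\diamond}(\bar x,\bar y):=\lim_{\rho\downarrow0}\ \inf_{\substack{d(x,\bar x)<\rho,\ d(y,\bar y)<\rho\\ (x,y)\in\mathrm{gph}\,F,\ x\notin F^{-1}(\bar y)}}|\nabla F|^{\diamond}_\rho(x,y).$$ *)

theory Defs
  imports "HOL-Analysis.Analysis"
begin

definition gph :: "('a \<Rightarrow> 'b set) \<Rightarrow> ('a \<times> 'b) set"
  where "gph F = {(x, y). y \<in> F x}"

definition sv_inv :: "('a \<Rightarrow> 'b set) \<Rightarrow> 'b \<Rightarrow> 'a set"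
  where "sv_inv F y = {x. y \<in> F x}"

text \<open>Unlike \<^const>\<open>infdist\<close>, which is 0 on the empty set, this distance takes the value
  \<open>\<infinity>\<close> there.\<close>

definition dist_to_set :: "'a::metric_space \<Rightarrow> 'a set \<Rightarrow> ennreal"
  where "dist_to_set x A = (INF a\<in>A. ennreal (dist x a))"

text \<open>The convention is \<open>c / 0 = \<infinity>\<close> for every \<open>c\<close>, including \<open>c = 0\<close>, whereas \<open>0 / 0 = 0\<close>
  for the division of \<^typ>\<open>ennreal\<close>.  The case \<open>0 / 0\<close> does occur below when \<open>sv_inv F ybar\<close>
  is not closed.\<close>

definition quot :: "ennreal \<Rightarrow> ennreal \<Rightarrow> ennreal"
  where "quot c e = (if e = 0 then \<infinity> else c / e)"

text \<open>When \<open>xbar\<close> is interior to \<open>sv_inv F ybar\<close>, the filter is trivial and the value is \<open>\<infinity>\<close>.\<close>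

definition subreg_const ::
    "('a::metric_space \<Rightarrow> 'b::metric_space set) \<Rightarrow> 'a \<Rightarrow> 'b \<Rightarrow> ennreal"
  where "subreg_const F xbar ybar =
    Liminf (at xbar within - sv_inv F ybar)
      (\<lambda>x. quot (dist_to_set ybar (F x)) (dist_to_set x (sv_inv F ybar)))"

definition dist_rho ::
    "real \<Rightarrow> 'a::metric_space \<times> 'b::metric_space \<Rightarrow> 'a \<times> 'b \<Rightarrow> real"
  where "dist_rho \<rho> p q = max (dist (fst p) (fst q)) (\<rho> * dist (snd p) (snd q))"

text \<open>Only \<open>\<rho> > 0\<close> is used, so the real quotient has a positive denominator.  The supremum is taken
  in \<^typ>\<open>ennreal\<close>; over the empty set it is 0.\<close>

definition nonlocal_slope ::
    "('a::metric_space \<Rightarrow> 'b::metric_space set) \<Rightarrow> 'b \<Rightarrow> real \<Rightarrow> 'a \<Rightarrow> 'b \<Rightarrow> ennreal"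
  where "nonlocal_slope F ybar \<rho> x y =
    (SUP (u, v) \<in> gph F - {(x, y)}.
       ennreal (max (dist y ybar - dist v ybar) 0 / dist_rho \<rho> (u, v) (x, y)))"

definition slope_inf ::
    "('a::metric_space \<Rightarrow> 'b::metric_space set) \<Rightarrow> 'a \<Rightarrow> 'b \<Rightarrow> real \<Rightarrow> ennreal"
  where "slope_inf F xbar ybar \<rho> =
    (INF (x, y) \<in> {(x, y). dist x xbar < \<rho> \<and> dist y ybar < \<rho> \<and>
                           (x, y) \<in> gph F \<and> x \<notin> sv_inv F ybar}.
       nonlocal_slope F ybar \<rho> x y)"

definition uniform_strict_slope ::
    "('a::metric_space \<Rightarrow> 'b::metric_space set) \<Rightarrow> 'a \<Rightarrow> 'b \<Rightarrow> ennreal"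
  where "uniform_strict_slope F xbar ybar = Lim (at_right 0) (slope_inf F xbar ybar)"

definition locally_closed_near :: "'a::topological_space set \<Rightarrow> 'a \<Rightarrow> bool"
  where "locally_closed_near S z \<longleftrightarrow>
    (\<exists>U. closed U \<and> z \<in> interior U \<and> closed (S \<inter> U))"

text \<open>\<open>slope_inf F xbar ybar\<close> is antitone on \<open>\<rho> > 0\<close>, so the limit defining \<^const>\<open>uniform_strict_slope\<close>
  exists.\<close>

lemma slope_inf_antimono:
  assumes "0 < \<rho>" "\<rho> \<le> \<sigma>"
  shows "slope_inf F xbar ybar \<sigma> \<le> slope_inf F xbar ybar \<rho>"
proof -
  have "nonlocal_slope F ybar \<sigma> x y \<le> nonlocal_slope F ybar \<rho> x y" for x y
    unfolding nonlocal_slope_def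
  proof (rule SUP_mono', clarsimp split: prod.split)
    show "ennreal (max (dist y ybar - dist v ybar) 0 / dist_rho \<sigma> (u, v) (x, y))
        \<le> ennreal (max (dist y ybar - dist v ybar) 0 / dist_rho \<rho> (u, v) (x, y))" for u v
    proof (cases "(u, v) = (x, y)")
      case False
      have "0 < dist_rho \<rho> (u, v) (x, y)"
        using False assms by (auto simp: dist_rho_def less_max_iff_disj)
      moreover have "dist_rho \<rho> (u, v) (x, y) \<le> dist_rho \<sigma> (u, v) (x, y)"
        unfolding dist_rho_def using assms by (intro max.mono mult_right_mono) auto
      ultimately show ?thesis
        by (intro ennreal_leI divide_left_mono) auto
    qed auto
  qed
  then show ?thesis
    unfolding slope_inf_def using assms by (intro INF_mono) force
qed

lemma slope_inf_tendsto:
  "(slope_inf F xbar ybar \<longlongrightarrow> uniform_strict_slope F xbar ybar) (at_right 0)"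
proof -
  let ?L = "SUP \<rho>\<in>{0<..}. slope_inf F xbar ybar \<rho>"
  have "(slope_inf F xbar ybar \<longlongrightarrow> ?L) (at_right 0)"
  proof (rule order_tendstoI)
    fix a assume "a < ?L"
    then obtain \<sigma> where \<sigma>: "0 < \<sigma>" "a < slope_inf F xbar ybar \<sigma>"
      by (auto simp: less_SUP_iff)
    have "a < slope_inf F xbar ybar \<rho>" if "0 < \<rho>" "\<rho> < \<sigma>" for \<rho>
      using slope_inf_antimono[of \<rho> \<sigma> F xbar ybar] that \<sigma> by (simp add: order.strict_trans2)
    then show "\<forall>\<^sub>F \<rho> in at_right 0. a < slope_inf F xbar ybar \<rho>"
      using \<sigma> by (auto simp: eventually_at_right)
  next
    fix a assume a: "?L < a"
    have "slope_inf F xbar ybar \<rho> < a" if "0 < \<rho>" for \<rho>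
      using that by (intro le_less_trans[OF SUP_upper a]) auto
    then show "\<forall>\<^sub>F \<rho> in at_right 0. slope_inf F xbar ybar \<rho> < a"
      using eventually_at_right_less by (rule eventually_mono[rotated])
  qed
  then show ?thesis
    unfolding uniform_strict_slope_def
    by (metis tendsto_Lim trivial_limit_at_right_real)
qed

end

(* Part (i): tau d(x, S) < d(ybar, F x) with S = F^{-1}(ybar) yields u in S with
   tau d(u, x) < d(y, ybar) for every y in F x, and the graph point (u, ybar) witnesses a slope of at
   least tau at (x, y) once rho <= 1/tau.
   Part (ii): if d(ybar, y) < tau d(x, S) with y in F x, then Ekeland's variational principle, applied
   to (u, v) |-> d(v, ybar) on the closed part of the graph, moves (x, y) by less than d(x, S), hence
   to a point still outside S, at which no competitor in that part gives a slope above tau.  The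
   remaining competitors stay at a fixed distance, so their quotients are small. *)

theory Submission
  imports Defs
begin

section \<open>Ekeland's variational principle\<close>

text \<open>Near-minimisers chosen in the nested sets \<open>T (p n)\<close> converge because these
  sets shrink to a point. Carrier and metric stay free so that a closed piece of a graph with
  \<open>dist_rho\<close> can be substituted; closed sublevel sets express lower
  semicontinuity.\<close>

lemma (in Metric_space) ekeland_variational_principle:
  fixes f :: "'a \<Rightarrow> real" and c :: real
  assumes compl: mcomplete
    and lsc: "\<And>a. closedin mtopology {x \<in> M. f x \<le> a}"
    and bdd: "bdd_below (f ` M)"
    and x0: "x0 \<in> M" and c: "0 < c"
  obtains z where "z \<in> M" "f z + c * d z x0 \<le> f x0"
    "\<And>q. \<lbrakk>q \<in> M; q \<noteq> z\<rbrakk> \<Longrightarrow> f z < f q + c * d q z"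
proof -
  \<comment> \<open>\<open>q \<in> T p\<close> is Ekeland's partial order: the decrease of
    \<open>f\<close> from \<open>p\<close> to \<open>q\<close> pays for the distance. The wanted
    \<open>z\<close> is a minimal element, one with \<open>T z = {z}\<close>.\<close>
  define T where "T p = {q \<in> M. f q + c * d q p \<le> f p}" for p
  have T_refl: "p \<in> T p" if "p \<in> M" for p
    using that by (simp add: T_def)
  have T_trans: "r \<in> T p" if "p \<in> M" "q \<in> T p" "r \<in> T q" for p q r
  proof -
    have "c * d r p \<le> c * (d r q + d q p)"
      using that c by (intro mult_left_mono triangle) (auto simp: T_def)
    then show ?thesis
      using that by (auto simp: T_def algebra_simps)
  qed
  have near_min: "\<exists>q. q \<in> M \<and> q \<in> T p \<and> (\<forall>r\<in>T p. f q \<le> f r + (1/2) ^ n)" if "p \<in> M" for p n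
  proof -
    have ne: "f ` T p \<noteq> {}"
      using T_refl[OF that] by auto
    have bdd': "bdd_below (f ` T p)"
      using bdd by (rule bdd_below_mono) (auto simp: T_def)
    have "Inf (f ` T p) < Inf (f ` T p) + (1/2) ^ n"
      by simp
    then obtain q where q: "q \<in> T p" "f q < Inf (f ` T p) + (1/2) ^ n"
      using ne bdd' by (subst (asm) cInf_less_iff) auto
    have "f q \<le> f r + (1/2) ^ n" if "r \<in> T p" for r
      using cInf_lower[OF imageI[OF that] bdd'] q by simp
    with q show ?thesis
      by (auto simp: T_def)
  qed
  obtain p where p0: "p 0 = x0" and pM: "\<And>n. p n \<in> M"
    and pT: "\<And>n. p (Suc n) \<in> T (p n)"
    and pmin: "\<And>n r. r \<in> T (p n) \<Longrightarrow> f (p (Suc n)) \<le> f r + (1/2) ^ n"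
  proof -
    have "\<exists>p. \<forall>n. (p n \<in> M \<and> (n = 0 \<longrightarrow> p n = x0)) \<and>
      (p (Suc n) \<in> T (p n) \<and> (\<forall>r\<in>T (p n). f (p (Suc n)) \<le> f r + (1/2) ^ n))"
      by (intro dependent_nat_choice) (use x0 near_min in auto)
    then show thesis
      using that by blast
  qed
  have chain: "p m \<in> T (p n)" if "n \<le> m" for m n
    using that by (induction m rule: dec_induct) (auto intro: T_refl T_trans pM pT)
  \<comment> \<open>By transitivity \<open>r\<close> also competed in the choice of
    \<open>p (Suc n)\<close>, so it lowers \<open>f\<close> by at most \<open>(1/2) ^ n\<close>;
    membership in \<open>T\<close> turns this decrease into a distance bound.\<close>
  have small: "c * d r (p (Suc n)) \<le> (1/2) ^ n" if "r \<in> T (p (Suc n))" for r n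
    using pmin[OF T_trans[OF pM pT that]] that by (simp add: T_def)
  have pow: "\<exists>n. (1/2) ^ n < e" if "0 < e" for e :: real
    using that by (intro real_arch_pow_inv) auto
  have "MCauchy p"
    unfolding MCauchy_def
  proof (intro conjI strip)
    fix e :: real assume "0 < e"
    then obtain N where N: "(1/2) ^ N < c * e / 2"
      using pow[of "c * e / 2"] c by auto
    have "d (p n) (p m) < e" if "Suc N \<le> n" "Suc N \<le> m" for n m
    proof -
      have "c * d (p n) (p m) \<le> c * d (p n) (p (Suc N)) + c * d (p m) (p (Suc N))"
        unfolding distrib_left[symmetric] using c by (intro mult_left_mono triangle' pM) auto
      also have "\<dots> < c * e"
        using small[OF chain[OF that(1)]] small[OF chain[OF that(2)]] N by linarith
      finally show ?thesis
        using c by simp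
    qed
    then show "\<exists>N. \<forall>n n'. N \<le> n \<longrightarrow> N \<le> n' \<longrightarrow> d (p n) (p n') < e"
      by blast
  qed (use pM in auto)
  then obtain z where "limitin mtopology p z sequentially"
    using compl by (auto simp: mcomplete_def)
  then have z: "z \<in> M" and lim: "\<And>e. 0 < e \<Longrightarrow> \<exists>N. \<forall>n\<ge>N. d (p n) z < e"
    unfolding limit_metric_sequentially by blast+
  have zT: "z \<in> T (p n)" for n
  proof -
    have "f z + c * d z (p n) \<le> f (p n) + e" if e: "0 < e" for e
    proof -
      \<comment> \<open>Lower semicontinuity at \<open>z\<close>: this closed sublevel set misses
        \<open>z\<close>, hence a whole ball around it. The other half of \<open>e\<close> pays for
        the distance from \<open>p m\<close> to \<open>z\<close>.\<close>
      let ?C = "{x \<in> M. f x \<le> f z - e / 2}"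
      have "\<exists>r>0. disjnt ?C (mball z r)"
        using lsc[of "f z - e / 2"] z e unfolding closedin_metric by auto
      then obtain r where r: "0 < r" "disjnt ?C (mball z r)"
        by blast
      obtain N where N: "\<And>m. N \<le> m \<Longrightarrow> d (p m) z < min r (e / (2 * c))"
        using lim[of "min r (e / (2 * c))"] r e c by auto
      \<comment> \<open>Beyond \<open>N\<close> the sequence is close to \<open>z\<close>; beyond
        \<open>n\<close> it stays in \<open>T (p n)\<close>.\<close>
      define m where "m = max N n"
      have dz: "d (p m) z < r" "c * d (p m) z < e / 2"
        using N[of m] c by (auto simp: m_def field_simps)
      have "f z - e / 2 < f (p m)"
        using r(2) dz(1) z pM[of m] by (auto simp: disjnt_iff commute)
      moreover have "f (p m) + c * d (p m) (p n) \<le> f (p n)"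
        using chain[of n m] by (simp add: m_def T_def)
      moreover have "c * d z (p n) \<le> c * d (p m) z + c * d (p m) (p n)"
        unfolding distrib_left[symmetric] using c by (intro mult_left_mono triangle'' z pM) auto
      ultimately show ?thesis
        using dz by linarith
    qed
    then show ?thesis
      using z by (auto simp: T_def intro: field_le_epsilon)
  qed
  show thesis
  proof
    show "z \<in> M" "f z + c * d z x0 \<le> f x0"
      using z zT[of 0] by (auto simp: T_def p0)
    fix q assume q: "q \<in> M" "q \<noteq> z"
    show "f z < f q + c * d q z"
    \<comment> \<open>A violation puts \<open>q\<close> below \<open>z\<close>, hence in every
      \<open>T (p n)\<close> along with \<open>z\<close>; the shrinking of these sets then forces
      \<open>q = z\<close>.\<close>
    proof (rule ccontr)
      assume "\<not> ?thesis"
      then have "q \<in> T z"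
        using q by (simp add: T_def)
      have "0 < c * d q z"
        using q z c by simp
      then obtain n where n: "(1/2) ^ n < c * d q z / 2"
        using pow[of "c * d q z / 2"] by auto
      have "c * d q z \<le> c * d q (p (Suc n)) + c * d z (p (Suc n))"
        unfolding distrib_left[symmetric] using c q z by (intro mult_left_mono triangle' pM) auto
      also have "\<dots> \<le> (1/2) ^ n + (1/2) ^ n"
        by (intro add_mono small zT T_trans[OF pM zT \<open>q \<in> T z\<close>])
      finally show False
        using n by simp
    qed
  qed
qed

section \<open>The weighted maximum metric on the product\<close>

lemma Metric_space_dist_rho:
  assumes "0 < \<rho>"
  shows "Metric_space S (dist_rho \<rho> :: 'a::metric_space \<times> 'b::metric_space \<Rightarrow> _)"
proof
  show "0 \<le> dist_rho \<rho> p q" "dist_rho \<rho> p q = dist_rho \<rho> q p" for p q :: "'a \<times> 'b"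
    by (auto simp: dist_rho_def dist_commute le_max_iff_disj)
  show "dist_rho \<rho> p q = 0 \<longleftrightarrow> p = q" for p q :: "'a \<times> 'b"
    using assms by (auto simp: dist_rho_def prod_eq_iff max_def not_le split: if_splits)
      (smt (verit, best) mult_pos_pos zero_le_dist zero_less_dist_iff)+
  fix p q r :: "'a \<times> 'b"
  have "\<rho> * dist (snd p) (snd r) \<le> \<rho> * dist (snd p) (snd q) + \<rho> * dist (snd q) (snd r)"
    unfolding distrib_left[symmetric] using assms by (intro mult_left_mono dist_triangle) auto
  then show "dist_rho \<rho> p r \<le> dist_rho \<rho> p q + dist_rho \<rho> q r"
    using dist_triangle[of "fst p" "fst r" "fst q"] by (auto simp: dist_rho_def)
qed

text \<open>Since \<rho> > 0, a sequence is Cauchy for \<open>dist_rho \<rho>\<close> only if both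
  coordinates are, and coordinatewise limits are limits for \<open>dist_rho \<rho>\<close>.\<close>

lemma mcomplete_dist_rho:
  fixes S :: "('a::metric_space \<times> 'b::metric_space) set"
  assumes \<rho>: "0 < \<rho>" and S: "closed S"
    and compl: "complete (UNIV :: 'a set)" "complete (UNIV :: 'b set)"
  shows "Metric_space.mcomplete S (dist_rho \<rho>)"
proof -
  interpret D: Metric_space S "dist_rho \<rho>"
    using \<rho> by (rule Metric_space_dist_rho)
  show ?thesis
    unfolding D.mcomplete_def
  proof (intro strip)
    fix s assume "D.MCauchy s"
    then have sS: "s n \<in> S" and cau: "\<And>e. 0 < e \<Longrightarrow> \<exists>N. \<forall>m\<ge>N. \<forall>n\<ge>N. dist_rho \<rho> (s m) (s n) < e" for n
      by (auto simp: D.MCauchy_def)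
    have "Cauchy (\<lambda>n. fst (s n))"
      unfolding Cauchy_def using cau by (fastforce simp: dist_rho_def)
    then obtain a where a: "(\<lambda>n. fst (s n)) \<longlonglongrightarrow> a"
      using compl(1) by (auto simp: complete_def)
    have "Cauchy (\<lambda>n. snd (s n))"
      unfolding Cauchy_def
    proof (intro strip)
      fix e :: real assume "0 < e"
      then obtain N where "\<forall>m\<ge>N. \<forall>n\<ge>N. dist_rho \<rho> (s m) (s n) < \<rho> * e"
        using cau[of "\<rho> * e"] \<rho> by auto
      then show "\<exists>M. \<forall>m\<ge>M. \<forall>n\<ge>M. dist (snd (s m)) (snd (s n)) < e"
        using \<rho> by (auto simp: dist_rho_def)
    qed
    then obtain b where b: "(\<lambda>n. snd (s n)) \<longlonglongrightarrow> b"
      using compl(2) by (auto simp: complete_def)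
    \<comment> \<open>Closedness of \<open>S\<close> refers to the product topology, so the limit is
      placed in \<open>S\<close> there before convergence in \<open>dist_rho\<close> is read
      off.\<close>
    have "(\<lambda>n. (fst (s n), snd (s n))) \<longlonglongrightarrow> (a, b)"
      using a b by (rule tendsto_Pair)
    then have "(a, b) \<in> S"
      using S sS by (auto intro: closed_sequentially)
    moreover have "(\<lambda>n. dist_rho \<rho> (s n) (a, b)) \<longlonglongrightarrow> max (dist a a) (\<rho> * dist b b)"
      unfolding dist_rho_def fst_conv snd_conv by (intro tendsto_intros a b)
    then have "\<forall>\<^sub>F n in sequentially. dist_rho \<rho> (s n) (a, b) < e" if "0 < e" for e
      using that by (auto dest: order_tendstoD(2))
    ultimately show "\<exists>x. limitin D.mtopology s x sequentially"
      using sS by (auto simp: D.limitin_metric)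
  qed
qed

section \<open>Distances as infima, the slope limit as a supremum\<close>

lemma dist_to_set_less_iff: "dist_to_set x A < e \<longleftrightarrow> (\<exists>a\<in>A. ennreal (dist x a) < e)"
  by (simp add: dist_to_set_def INF_less_iff)

text \<open>Antitonicity in \<rho> removes the limit: a lower bound on the slope then needs a single
  \<rho>, and an upper bound is proved for each \<rho> > 0 separately.\<close>

lemma uniform_strict_slope_eq_SUP:
  "uniform_strict_slope F xbar ybar = (SUP \<rho>\<in>{0<..}. slope_inf F xbar ybar \<rho>)"
proof (rule antisym)
  show "uniform_strict_slope F xbar ybar \<le> (SUP \<rho>\<in>{0<..}. slope_inf F xbar ybar \<rho>)"
  proof (rule tendsto_upperbound[OF slope_inf_tendsto])
    show "\<forall>\<^sub>F \<rho> in at_right 0. slope_inf F xbar ybar \<rho> \<le> (SUP \<rho>\<in>{0<..}. slope_inf F xbar ybar \<rho>)"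
      using eventually_at_right_less by (rule eventually_mono) (auto intro: SUP_upper)
  qed simp
  show "(SUP \<rho>\<in>{0<..}. slope_inf F xbar ybar \<rho>) \<le> uniform_strict_slope F xbar ybar"
  proof (rule SUP_least)
    fix \<sigma> :: real assume "\<sigma> \<in> {0<..}"
    then have "\<forall>\<^sub>F \<rho> in at_right 0. slope_inf F xbar ybar \<sigma> \<le> slope_inf F xbar ybar \<rho>"
      by (auto simp: eventually_at_right intro!: exI[of _ \<sigma>] slope_inf_antimono)
    then show "slope_inf F xbar ybar \<sigma> \<le> uniform_strict_slope F xbar ybar"
      using slope_inf_tendsto[of F xbar ybar] by (auto intro: tendsto_lowerbound)
  qed
qed

section \<open>The inequality in arbitrary metric spaces\<close>

lemma subreg_const_le_uniform_strict_slope: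
  fixes F :: "'a::metric_space \<Rightarrow> 'b::metric_space set"
  assumes bar: "(xbar, ybar) \<in> gph F"
  shows "subreg_const F xbar ybar \<le> uniform_strict_slope F xbar ybar"
proof (rule dense_le)
  let ?S = "sv_inv F ybar"
  have xS: "xbar \<in> ?S"
    using bar by (simp add: gph_def sv_inv_def)
  fix t assume t: "t < subreg_const F xbar ybar"
  show "t \<le> uniform_strict_slope F xbar ybar"
  proof (cases "t = 0")
    case False
    with t obtain \<tau> where \<tau>: "t = ennreal \<tau>" "0 < \<tau>"
      by (cases t) (auto simp: top_unique)
    have "\<forall>\<^sub>F x in at xbar within - ?S. t < quot (dist_to_set ybar (F x)) (dist_to_set x ?S)"
      using t unfolding subreg_const_def by (rule less_LiminfD)
    \<comment> \<open>\<open>eventually_at\<close> excludes the centre, which costs nothing because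
      \<open>xbar\<close> lies in \<open>?S\<close>.\<close>
    then obtain r where r: "0 < r" and quot:
      "\<And>x. x \<notin> ?S \<Longrightarrow> dist x xbar < r \<Longrightarrow> t < quot (dist_to_set ybar (F x)) (dist_to_set x ?S)"
      using xS unfolding eventually_at by (metis ComplI)
    \<comment> \<open>The bound \<open>r\<close> keeps \<open>x\<close> where \<open>quot\<close>
      applies; \<open>1 / \<tau>\<close> ensures that the second coordinate's part of
      \<open>\<tau> * ?D\<close> is at most \<delta>.\<close>
    define \<rho> where "\<rho> = min r (1 / \<tau>)"
    have \<rho>: "0 < \<rho>" "\<rho> \<le> r" "\<rho> * \<tau> \<le> 1"
      using r \<tau> by (auto simp: \<rho>_def min_def field_simps)
    have "t \<le> slope_inf F xbar ybar \<rho>"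
      unfolding slope_inf_def
    proof (rule INF_greatest, clarify)
      fix x y
      assume xy: "dist x xbar < \<rho>" "(x, y) \<in> gph F" "x \<notin> ?S"
      define \<delta> where "\<delta> = dist y ybar"
      have y: "y \<in> F x" "y \<noteq> ybar" "0 < \<delta>"
        using xy by (auto simp: gph_def sv_inv_def \<delta>_def)
      have "dist_to_set x ?S < ennreal (\<delta> / \<tau>)"
      \<comment> \<open>\<open>x\<close> may be a limit point of \<open>?S\<close> outside it. Then
        \<open>quot\<close> is \<infinity> by convention and carries no information, but the claim
        follows from \<delta> > 0.\<close>
      proof (cases "dist_to_set x ?S = 0")
        case True
        then show ?thesis using y \<tau> by (simp add: ennreal_less_zero_iff)
      next
        case False
        have "dist_to_set x ?S \<le> dist x xbar"
          using xS by (auto simp: dist_to_set_def intro: INF_lower)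
        with False obtain s where s: "dist_to_set x ?S = ennreal s" "0 < s"
          by (cases "dist_to_set x ?S") (auto simp: top_unique)
        have "ennreal \<tau> < dist_to_set ybar (F x) / ennreal s"
          using quot[of x] xy \<rho> False by (simp add: quot_def \<tau> s)
        also have "\<dots> \<le> ennreal \<delta> / ennreal s"
          using y by (intro divide_right_mono_ennreal)
            (auto simp: dist_to_set_def \<delta>_def dist_commute intro!: INF_lower2)
        finally have "\<tau> < \<delta> / s"
          using s y \<tau> by (simp add: divide_ennreal ennreal_less_iff)
        then show ?thesis
          using s \<tau> by (simp add: ennreal_less_iff field_simps)
      qed
      then obtain u where u: "u \<in> ?S" "\<tau> * dist u x < \<delta>"
        using \<tau> by (auto simp: dist_to_set_less_iff ennreal_less_iff field_simps dist_commute)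
      let ?D = "dist_rho \<rho> (u, ybar) (x, y)"
      have "0 < ?D"
        using y \<rho> by (simp add: dist_rho_def less_max_iff_disj dist_commute)
      moreover have "\<tau> * ?D \<le> \<delta>"
      proof -
        have "\<tau> * (\<rho> * dist ybar y) \<le> 1 * \<delta>"
          unfolding mult.assoc[symmetric] \<delta>_def using \<rho>
          by (intro mult_mono) (auto simp: mult.commute dist_commute)
        with u \<tau> show ?thesis
          by (auto simp: dist_rho_def max_def)
      qed
      ultimately have "\<tau> \<le> \<delta> / ?D"
        by (simp add: field_simps)
      then have "t \<le> ennreal (max (dist y ybar - dist ybar ybar) 0 / ?D)"
        using \<tau> by (auto simp: \<delta>_def intro: ennreal_leI)
      also have "\<dots> \<le> nonlocal_slope F ybar \<rho> x y"
        unfolding nonlocal_slope_def using u y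
        by (intro SUP_upper2[of "(u, ybar)"]) (auto simp: gph_def sv_inv_def)
      finally show "t \<le> nonlocal_slope F ybar \<rho> x y" .
    qed
    then show ?thesis
      unfolding uniform_strict_slope_eq_SUP using \<rho> by (auto intro: SUP_upper2)
  qed simp
qed

section \<open>The reverse inequality under completeness and local closedness\<close>

lemma uniform_strict_slope_le_subreg_const:
  fixes F :: "'a::metric_space \<Rightarrow> 'b::metric_space set"
  assumes bar: "(xbar, ybar) \<in> gph F"
    and compl: "complete (UNIV :: 'a set)" "complete (UNIV :: 'b set)"
    and lc: "locally_closed_near (gph F) (xbar, ybar)"
  shows "uniform_strict_slope F xbar ybar \<le> subreg_const F xbar ybar"
proof (rule dense_ge)
  let ?S = "sv_inv F ybar"
  have xS: "xbar \<in> ?S"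
    using bar by (simp add: gph_def sv_inv_def)
  fix t assume t: "subreg_const F xbar ybar < t"
  show "uniform_strict_slope F xbar ybar \<le> t"
  proof (cases t)
    case top
    then show ?thesis by simp
  next
    case (real \<tau>)
    with t have \<tau>: "t = ennreal \<tau>" "0 < \<tau>"
      by (auto simp: ennreal_zero_less_one) (metis ennreal_less_zero_iff gr_zeroI not_less_zero)
    obtain U where U: "(xbar, ybar) \<in> interior U" "closed (gph F \<inter> U)"
      using lc by (auto simp: locally_closed_near_def)
    obtain e0 where e0: "0 < e0" "ball (xbar, ybar) e0 \<subseteq> U"
      using U(1) by (auto simp: mem_interior)
    \<comment> \<open>The product distance is at most the sum of the coordinate distances, so
      halving \<open>e0\<close> fits a coordinate box into \<open>U\<close>.\<close>
    define \<epsilon> where "\<epsilon> = e0 / 2"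
    have \<epsilon>: "0 < \<epsilon>" using e0 by (simp add: \<epsilon>_def)
    have inU: "(u, v) \<in> U" if "dist u xbar < \<epsilon>" "dist v ybar < \<epsilon>" for u v
    proof -
      have "dist (xbar, ybar) (u, v) \<le> dist xbar u + dist ybar v"
        by (simp add: dist_prod_def sqrt_sum_squares_le_sum)
      also have "\<dots> < e0" using that by (simp add: \<epsilon>_def dist_commute)
      finally show ?thesis using e0 by auto
    qed
    have "slope_inf F xbar ybar \<rho> \<le> t" if \<rho>: "0 < \<rho>" for \<rho>
    proof -
      \<comment> \<open>A lower bound for \<open>dist_rho \<rho>\<close> between a point outside
        \<open>U\<close> and a point whose coordinates are both within \<open>\<epsilon> / 2\<close>
        of the base point.\<close>
      define \<kappa> where "\<kappa> = min (\<epsilon> / 2) (\<rho> * (\<epsilon> / 2))"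
      \<comment> \<open>The radius for the Ekeland point: \<rho> makes it admissible in
        \<open>slope_inf\<close>, \<open>\<epsilon> / 2\<close> keeps it away from the complement of
        \<open>U\<close>, and \<open>\<tau> * \<kappa>\<close> controls the numerators of
        competitors outside \<open>U\<close>.\<close>
      define \<eta> where "\<eta> = min (min \<rho> (\<epsilon> / 2)) (\<tau> * \<kappa>)"
      \<comment> \<open>With \<open>s \<le> dist x xbar < r\<close>, the Ekeland point has first
        coordinate within \<open>s + r < 2 * r\<close> of \<open>xbar\<close>, and \<open>y\<close>
        satisfies \<open>dist y ybar < \<tau> * s \<le> \<tau> * r\<close>; both bounds must be at
        most \<eta>.\<close>
      define r where "r = min (\<eta> / 2) (\<eta> / \<tau>)"
      have \<kappa>: "0 < \<kappa>" using \<epsilon> \<rho> by (simp add: \<kappa>_def)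
      have \<eta>: "0 < \<eta>" "\<eta> \<le> \<rho>" "\<eta> \<le> \<epsilon> / 2" "\<eta> \<le> \<tau> * \<kappa>"
        using \<epsilon> \<rho> \<kappa> \<tau> by (auto simp: \<eta>_def)
      have r: "0 < r" "2 * r \<le> \<eta>" "\<tau> * r \<le> \<eta>"
        using \<eta> \<tau> by (auto simp: r_def min_def field_simps)
      have "\<exists>x. x \<notin> ?S \<and> dist x xbar < r \<and> quot (dist_to_set ybar (F x)) (dist_to_set x ?S) < t"
      proof (rule ccontr)
        assume "\<not> ?thesis"
        then have "\<forall>\<^sub>F x in at xbar within - ?S. t \<le> quot (dist_to_set ybar (F x)) (dist_to_set x ?S)"
          using r(1) unfolding eventually_at not_less by (metis ComplD not_le)
        then have "t \<le> subreg_const F xbar ybar"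
          unfolding subreg_const_def by (rule Liminf_bounded)
        with t show False by simp
      qed
      then obtain x where x: "x \<notin> ?S" "dist x xbar < r"
        and quot: "quot (dist_to_set ybar (F x)) (dist_to_set x ?S) < t"
        by blast
      have ds_le: "dist_to_set x ?S \<le> dist x u" if "u \<in> ?S" for u
        using that by (auto simp: dist_to_set_def intro: INF_lower)
      \<comment> \<open>The convention c/0 = \<infinity> matters here: a quotient below
        \<open>t\<close> forces a positive distance.\<close>
      have "dist_to_set x ?S \<noteq> 0"
        using quot by (auto simp: quot_def)
      with ds_le[OF xS] obtain s where s: "dist_to_set x ?S = ennreal s" "0 < s"
        by (cases "dist_to_set x ?S") (auto simp: top_unique)
      have s_le: "s \<le> dist x u" if "u \<in> ?S" for u
        using ds_le[OF that] by (simp add: s)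
      have "dist_to_set ybar (F x) < ennreal (\<tau> * s)"
      proof (rule ccontr)
        assume "\<not> ?thesis"
        then have "ennreal (\<tau> * s) / ennreal s \<le> dist_to_set ybar (F x) / ennreal s"
          by (intro divide_right_mono_ennreal) simp
        then have "t \<le> dist_to_set ybar (F x) / ennreal s"
          using s \<tau> by (simp add: divide_ennreal)
        with quot s show False
          by (simp add: quot_def)
      qed
      then obtain y where y: "y \<in> F x" "dist y ybar < \<tau> * s"
        by (auto simp: dist_to_set_less_iff ennreal_less_iff dist_commute)
      have "\<tau> * s \<le> \<tau> * r"
        using s_le[OF xS] x \<tau> by (intro mult_left_mono) auto
      then have y\<eta>: "dist y ybar < \<eta>"
        using y r by linarith
      have xy: "(x, y) \<in> gph F \<inter> U"
        using y y\<eta> x r \<eta> \<epsilon> by (auto simp: gph_def intro!: inU)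
      interpret D: Metric_space "gph F \<inter> U" "dist_rho \<rho>"
        using \<rho> by (rule Metric_space_dist_rho)
      \<comment> \<open>For \<open>dist_rho \<rho>\<close> the function (u, v) \<mapsto> d(v, ybar)
        is Lipschitz with constant 1/\<rho>, whence the radius \<open>?r\<close>.\<close>
      have closedin_le: "closedin D.mtopology {p \<in> gph F \<inter> U. dist (snd p) ybar \<le> a}" for a
        unfolding D.closedin_metric
      proof (intro conjI strip)
        fix p assume p: "p \<in> gph F \<inter> U - {p \<in> gph F \<inter> U. dist (snd p) ybar \<le> a}"
        let ?r = "\<rho> * (dist (snd p) ybar - a)"
        have "a < dist (snd q) ybar" if "dist_rho \<rho> p q < ?r" for q
        proof -
          have "\<rho> * dist (snd p) (snd q) < ?r"
            using that by (simp add: dist_rho_def)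
          then have "dist (snd p) (snd q) < dist (snd p) ybar - a"
            using \<rho> by simp
          then show ?thesis
            using dist_triangle[of "snd p" ybar "snd q"] by linarith
        qed
        moreover have "0 < ?r"
          using p \<rho> by (auto simp: not_le)
        ultimately show "\<exists>r>0. disjnt {p \<in> gph F \<inter> U. dist (snd p) ybar \<le> a} (D.mball p r)"
          by (intro exI[of _ ?r]) (auto simp: disjnt_iff not_le)
      qed auto
      \<comment> \<open>Taking \<tau> as Ekeland's weight makes strict minimality of
        \<open>z\<close> the slope bound \<tau> over competitors in \<open>U\<close>, while the
        decrease inequality limits how far \<open>z\<close> is from \<open>(x, y)\<close>.\<close>
      obtain z where z: "z \<in> gph F \<inter> U"
        "dist (snd z) ybar + \<tau> * dist_rho \<rho> z (x, y) \<le> dist (snd (x, y)) ybar"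
        "\<And>q. \<lbrakk>q \<in> gph F \<inter> U; q \<noteq> z\<rbrakk> \<Longrightarrow> dist (snd z) ybar < dist (snd q) ybar + \<tau> * dist_rho \<rho> q z"
        using D.ekeland_variational_principle[OF mcomplete_dist_rho[OF \<rho> U(2) compl] closedin_le _ xy \<tau>(2)]
        by (metis (no_types, lifting) bdd_belowI2 zero_le_dist)
      obtain x' y' where z_eq: "z = (x', y')" by (cases z)
      have y': "dist y' ybar < \<eta>"
      proof -
        have "0 \<le> \<tau> * dist_rho \<rho> (x', y') (x, y)"
          using \<tau> by simp
        then show ?thesis
          using z(2) y\<eta> unfolding z_eq snd_conv by linarith
      qed
      have "\<tau> * dist x' x \<le> \<tau> * dist_rho \<rho> (x', y') (x, y)"
        using \<tau> by (intro mult_left_mono) (auto simp: dist_rho_def)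
      also have "\<dots> < \<tau> * s"
        using z(2) y(2) zero_le_dist[of y' ybar] unfolding z_eq snd_conv by linarith
      finally have x'x: "dist x' x < s"
        using \<tau> by simp
      then have x'S: "x' \<notin> ?S"
        using s_le[of x'] by (auto simp: dist_commute)
      have x': "dist x' xbar < \<eta>"
        using x'x s_le[OF xS] x r dist_triangle[of x' xbar x] by linarith
      have "nonlocal_slope F ybar \<rho> x' y' \<le> t"
        unfolding nonlocal_slope_def
      proof (rule SUP_least, unfold split_paired_all prod.case)
        fix u v assume "(u, v) \<in> gph F - {(x', y')}"
        then have uv: "(u, v) \<in> gph F" "(u, v) \<noteq> (x', y')"
          by simp_all
        let ?D = "dist_rho \<rho> (u, v) (x', y')"
        have D: "0 < ?D"
          using uv \<rho> by (auto simp: dist_rho_def less_max_iff_disj)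
        have "dist y' ybar - dist v ybar \<le> \<tau> * ?D"
        proof (cases "(u, v) \<in> U")
          case True
          then show ?thesis using z(3)[of "(u, v)"] uv by (simp add: z_eq)
        next
          case False
          \<comment> \<open>For competitors outside \<open>U\<close> the denominator is at least
            \<kappa>, while the numerator is at most
            \<open>dist y' ybar < \<eta> \<le> \<tau> * \<kappa>\<close>.\<close>
          then consider "\<epsilon> \<le> dist u xbar" | "\<epsilon> \<le> dist v ybar"
            using inU[of u v] by linarith
          then have "\<kappa> \<le> ?D"
          proof cases
            case 1
            then have "\<epsilon> / 2 \<le> dist u x'"
              using x' \<eta> dist_triangle[of u xbar x'] by linarith
            then show ?thesis by (simp add: dist_rho_def \<kappa>_def min_le_iff_disj le_max_iff_disj)
          next
            case 2
            then have "\<epsilon> / 2 \<le> dist v y'"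
              using y' \<eta> dist_triangle[of v ybar y'] by linarith
            then have "\<rho> * (\<epsilon> / 2) \<le> \<rho> * dist v y'"
              using \<rho> by simp
            then show ?thesis unfolding dist_rho_def \<kappa>_def fst_conv snd_conv by linarith
          qed
          then have "\<tau> * \<kappa> \<le> \<tau> * ?D"
            using \<tau> by simp
          then show ?thesis
            using y' \<eta> zero_le_dist[of v ybar] by linarith
        qed
        then have "max (dist y' ybar - dist v ybar) 0 / ?D \<le> \<tau>"
          using D \<tau> by (simp add: divide_le_eq)
        then show "ennreal (max (dist y' ybar - dist v ybar) 0 / ?D) \<le> t"
          using \<tau> by (auto intro: ennreal_leI)
      qed
      moreover have "slope_inf F xbar ybar \<rho> \<le> nonlocal_slope F ybar \<rho> x' y'"
        unfolding slope_inf_def using x' y' \<eta> x'S z(1) z_eq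
        by (intro INF_lower2[of "(x', y')"]) auto
      ultimately show ?thesis by simp
    qed
    then show ?thesis
      unfolding uniform_strict_slope_eq_SUP by (auto intro: SUP_least)
  qed
qed

theorem theorem5p6:
  fixes F :: "'a::metric_space \<Rightarrow> 'b::metric_space set"
    and xbar :: 'a and ybar :: 'b
  assumes "(xbar, ybar) \<in> gph F"
  shows "subreg_const F xbar ybar \<le> uniform_strict_slope F xbar ybar \<and>
    (complete (UNIV :: 'a set) \<and> complete (UNIV :: 'b set) \<and>
       locally_closed_near (gph F) (xbar, ybar) \<longrightarrow>
     subreg_const F xbar ybar = uniform_strict_slope F xbar ybar)"
  using subreg_const_le_uniform_strict_slope[OF assms]
    uniform_strict_slope_le_subreg_const[OF assms]
  by (auto intro: antisym)

end
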